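(* For any positive integer $n$ and $|z|<1$ we have \begin{align*} \sum_{m>n}\frac{b_m(z)}{2m}&=f_2(z)\int_0^z b_n(t)\,\omega_1,\\ \sum_{m>n}\frac{b_m(z)}{(2m)^s}&=f_1(z)\int_0^z\omega_0^{s-2}\,\omega_1\,b_n(t)\omega_1\quad\forall s\ge2,\\ \sum_{m\ge n}\frac{b_m(z)}{2m+1}&=f_{20}(z)\int_0^z b_n(t)\,\omega_1,\\ \sum_{m\ge n}\frac{b_m(z)}{(2m+1)^s}&=f_3(z)\int_0^z\omega_0^{s-2}\,\omega_3\,b_n(t)\omega_1\quad\forall s\ge2,\\ \sum_{m>n}\frac{b_m(z)}{2m-1}&=f_5(z)\int_0^z\omega_3\,b_n(t)\omega_1+f_2(z)\int_0^z b_n(t)\,\omega_1,\\ \sum_{m>n}\frac{b_m(z)}{(2m-1)^s}&=f_5(z)\int_0^z(\omega_0+1)\,\omega_0^{s-2}\,\omega_3\,b_n(t)\omega_1\quad\forall s\ge2. \end{align*}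
   Context: Let $b_0(z)=1$ and $b_n(z)=\frac{4^nz^{2n}}{\binom{2n}{n}}$ for $n\ge0$. Define $f_1(t)=1$, $f_2(t)=\frac{t}{\sqrt{1-t^2}}$, $f_3(t)=\frac1t$, $f_{20}(t)=\frac{1}{t\sqrt{1-t^2}}$, $f_5(t)=t$, and the 1-forms $\omega_0=\frac{dt}{t}$, $\omega_1=\frac{dt}{\sqrt{1-t^2}}$, $\omega_2=\frac{t\,dt}{1-t^2}$, $\omega_3=\frac{dt}{t\sqrt{1-t^2}}$, $\omega_{20}=\omega_2+\omega_0=\frac{dt}{t(1-t^2)}$, so that $f_j(t)\omega_1=\omega_j$. Iterated integrals are Chen's: $\int_0^z\varphi_1\varphi_2\cdots\varphi_r=\int_0^z\varphi_1(t_1)\int_0^{t_1}\varphi_2(t_2)\cdots\int_0^{t_{r-1}}\varphi_r(t_r)$ (first form outermost); $\omega_0^{k}$ means $\omega_0$ repeated $k$ times (empty if $k=0$); $b_n(t)\omega_1$ denotes the 1-form $b_n(t)\frac{dt}{\sqrt{1-t^2}}$; and $\int_0^z(\omega_0+1)W$ means $\int_0^z\omega_0W+\int_0^zW$. *)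

theory Defs
  imports "HOL-Complex_Analysis.Complex_Analysis"
begin

definition b :: "nat \<Rightarrow> complex \<Rightarrow> complex" where
  "b n z = 4 ^ n * z ^ (2 * n) / of_nat ((2 * n) choose n)"

text \<open>
  Every square root below is evaluated at \<open>1 - t\<^sup>2\<close> with \<open>norm t < 1\<close>, which has positive real
  part; there the principal branch is holomorphic and agrees with the real square root on reals.
\<close>

definition f\<^sub>1 :: "complex \<Rightarrow> complex" where
  "f\<^sub>1 t = 1"

definition f\<^sub>2 :: "complex \<Rightarrow> complex" where
  "f\<^sub>2 t = t / csqrt (1 - t\<^sup>2)"

definition f\<^sub>3 :: "complex \<Rightarrow> complex" where
  "f\<^sub>3 t = 1 / t"

definition f\<^sub>2\<^sub>0 :: "complex \<Rightarrow> complex" where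
  "f\<^sub>2\<^sub>0 t = 1 / (t * csqrt (1 - t\<^sup>2))"

definition f\<^sub>5 :: "complex \<Rightarrow> complex" where
  "f\<^sub>5 t = t"

text \<open>A 1-form \<open>\<phi>(t) dt\<close> is represented by its coefficient function \<open>\<phi>\<close>.\<close>

type_synonym one_form = "complex \<Rightarrow> complex"

definition \<omega>\<^sub>0 :: one_form where
  "\<omega>\<^sub>0 t = 1 / t"

definition \<omega>\<^sub>1 :: one_form where
  "\<omega>\<^sub>1 t = 1 / csqrt (1 - t\<^sup>2)"

definition \<omega>\<^sub>3 :: one_form where
  "\<omega>\<^sub>3 t = 1 / (t * csqrt (1 - t\<^sup>2))"

definition b\<omega>\<^sub>1 :: "nat \<Rightarrow> one_form" where
  "b\<omega>\<^sub>1 n t = b n t * \<omega>\<^sub>1 t"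

text \<open>
  Chen's iterated integral from 0 to \<open>z\<close>, first form outermost, with every integration along a
  straight segment starting at 0. The poles of \<open>\<omega>\<^sub>0\<close> and \<open>\<omega>\<^sub>3\<close> at 0 are harmless when the inner
  integral vanishes there; the value of the integrand at the single point 0 is irrelevant.
\<close>

primrec iterated_integral :: "one_form list \<Rightarrow> complex \<Rightarrow> complex" where
  "iterated_integral [] z = 1"
| "iterated_integral (\<phi> # W) z =
     contour_integral (linepath 0 z) (\<lambda>t. \<phi> t * iterated_integral W t)"

end

theory Submission
  imports Defs "HOL-Real_Asymp.Real_Asymp"
begin

text \<open>
  Write \<open>a m = 4 ^ m / (2 m choose m)\<close>, so that \<open>a (m + 1) = a m * (2 m + 2) / (2 m + 1)\<close>, and let
  \<open>F s z\<close> be the sum of \<open>a m * z ^ (2 m + 1) / (2 m + 1) ^ s\<close> over \<open>m \<ge> n\<close>. The recurrence says that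
  \<open>F 1\<close> solves \<open>(1 - z\<^sup>2) y' - z y = b n z\<close>, and the integrating factor \<open>csqrt (1 - z\<^sup>2)\<close> identifies
  \<open>csqrt (1 - z\<^sup>2) * F 1 z\<close> with the integral of the innermost form. Integrating against
  \<open>dt / t\<close> raises \<open>s\<close> by one. The recurrence also turns the sums with denominators \<open>2 m\<close> and
  \<open>2 m - 1\<close> into such series.
\<close>

section \<open>Weighted power series and their derivatives\<close>

text \<open>The same number \<open>2 * j + q\<close> is exponent and denominator, so that
  \<open>z * d/dz\<close> lowers \<open>s\<close> by one. Coefficients and offset stay general
  because both parities of the exponent occur below.\<close>

definition weighted_term :: "(nat \<Rightarrow> complex) \<Rightarrow> nat \<Rightarrow> nat \<Rightarrow> complex \<Rightarrow> nat \<Rightarrow> complex" where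
  "weighted_term c q s z j = c j * z ^ (2 * j + q) / of_nat (2 * j + q) ^ s"

definition weighted_series :: "(nat \<Rightarrow> complex) \<Rightarrow> nat \<Rightarrow> nat \<Rightarrow> complex \<Rightarrow> complex" where
  "weighted_series c q s z = (\<Sum>j. weighted_term c q s z j)"

text \<open>For \<open>q > 0\<close> every denominator is at least 1 in norm, so the power series
  with coefficients \<open>c\<close> dominates. In the applications \<open>w\<close> is
  \<open>z\<^sup>2\<close>.\<close>

lemma summable_norm_weighted:
  fixes c :: "nat \<Rightarrow> complex"
  assumes "conv_radius c \<ge> 1" "norm w < 1" "q > 0"
  shows "summable (\<lambda>j. norm (c j / of_nat (2 * j + q) ^ s * w ^ j))"
proof (rule summable_comparison_test')
  show "summable (\<lambda>j. norm (c j * w ^ j))"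
  proof (rule abs_summable_in_conv_radius)
    have "ereal (norm w) < 1"
      using assms(2) by (simp add: one_ereal_def)
    then show "ereal (norm w) < conv_radius c"
      using assms(1) by (rule less_le_trans)
  qed
  fix j :: nat
  have "1 \<le> norm (of_nat (2 * j + q) ^ s :: complex)"
    using assms(3) unfolding norm_power norm_of_nat by (intro one_le_power) simp
  then have "norm (c j) * norm w ^ j / norm (of_nat (2 * j + q) ^ s :: complex)
      \<le> norm (c j) * norm w ^ j / 1"
    by (intro frac_le) simp_all
  then show "norm (norm (c j / of_nat (2 * j + q) ^ s * w ^ j)) \<le> norm (c j * w ^ j)"
    by (simp add: norm_mult norm_divide norm_power)
qed

lemma summable_norm_weighted_term:
  assumes "conv_radius c \<ge> 1" "norm z < 1" "q > 0"
  shows "summable (\<lambda>j. norm (weighted_term c q s z j))"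
proof -
  have "norm (z\<^sup>2) < 1"
    using assms(2) by (simp add: norm_power power_less_one_iff)
  from summable_mult[OF summable_norm_weighted[OF assms(1) this assms(3)], of "norm z ^ q" s]
  show ?thesis
    by (rule back_subst[of summable])
      (simp add: weighted_term_def fun_eq_iff norm_mult norm_divide norm_power power_add power_mult)
qed

lemma weighted_term_sums:
  assumes "conv_radius c \<ge> 1" "norm z < 1" "q > 0"
  shows "weighted_term c q s z sums weighted_series c q s z"
  unfolding weighted_series_def
  using summable_norm_cancel[OF summable_norm_weighted_term[OF assms]] by (rule summable_sums)

text \<open>The final sums are unordered sums over sets of naturals; absolute convergence supplies
  them.\<close>

lemma weighted_term_has_sum:
  assumes "conv_radius c \<ge> 1" "norm z < 1" "q > 0"
  shows "(weighted_term c q s z has_sum weighted_series c q s z) UNIV"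
  by (rule norm_summable_imp_has_sum[OF summable_norm_weighted_term weighted_term_sums]) fact+

lemma weighted_series_at_0: "q > 0 \<Longrightarrow> weighted_series c q s 0 = 0"
  by (simp add: weighted_series_def weighted_term_def power_0_left)

text \<open>
  Since \<open>q \<ge> 2\<close>, the series has a double zero at 0, so at \<open>z = 0\<close> the convention \<open>x / 0 = 0\<close> gives
  the true value of the derivative.
\<close>

lemma has_field_derivative_weighted_series:
  assumes c: "conv_radius c \<ge> 1" and z: "norm z < 1" and q: "q \<ge> 2"
  shows "(weighted_series c q (Suc s) has_field_derivative weighted_series c q s z / z) (at z)"
proof -
  \<comment> \<open>Factoring out \<open>z ^ q\<close> leaves an ordinary power series
    \<open>H\<close> in \<open>z\<^sup>2\<close>, to which termwise differentiation applies.\<close>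
  define d where "d j = c j / of_nat (2 * j + q) ^ Suc s" for j
  define H where "H w = (\<Sum>j. d j * w ^ j)" for w
  define H' where "H' w = (\<Sum>j. diffs d j * w ^ j)" for w
  have sm: "summable (\<lambda>j. d j * w ^ j)" if "norm w < 1" for w
    unfolding d_def by (rule summable_norm_cancel[OF summable_norm_weighted[OF c that]]) (use q in simp)
  have series_eq: "weighted_series c q (Suc s) w = w ^ q * H (w\<^sup>2)" if "norm w < 1" for w
  proof -
    have "norm (w\<^sup>2) < 1"
      using that by (simp add: norm_power power_less_one_iff)
    moreover have "weighted_term c q (Suc s) w = (\<lambda>j. w ^ q * (d j * (w\<^sup>2) ^ j))"
      by (simp add: weighted_term_def d_def power_add power_mult fun_eq_iff)
    ultimately show ?thesis
      unfolding weighted_series_def H_def by (simp add: suminf_mult sm)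
  qed
  have z2: "norm (z\<^sup>2) < 1"
    using z by (simp add: norm_power power_less_one_iff)
  have der: "(H has_field_derivative H' (z\<^sup>2)) (at (z\<^sup>2))"
    unfolding H_def H'_def by (rule termdiffs_strong'[OF sm z2])
  have "((\<lambda>w. H (w\<^sup>2)) has_field_derivative H' (z\<^sup>2) * (2 * z)) (at z)"
    by (rule DERIV_chain2[where g = "\<lambda>w. w\<^sup>2", OF der]) (auto intro!: derivative_eq_intros)
  then have D: "((\<lambda>w. w ^ q * H (w\<^sup>2)) has_field_derivative
      of_nat q * z ^ (q - 1) * H (z\<^sup>2) + z ^ q * (H' (z\<^sup>2) * (2 * z))) (at z)"
    by (auto intro!: derivative_eq_intros)
  have "(\<lambda>j. diffs d j * (z\<^sup>2) ^ j) sums H' (z\<^sup>2)"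
    unfolding H'_def by (intro summable_sums termdiff_converges[OF z2 sm])
  from sums_mult[OF this, of "z\<^sup>2"]
  have "(\<lambda>j. of_nat (Suc j) * d (Suc j) * (z\<^sup>2) ^ Suc j) sums (z\<^sup>2 * H' (z\<^sup>2))"
    by (simp only: diffs_def power_Suc mult.assoc mult.left_commute[of "z\<^sup>2"])
  \<comment> \<open>The term of index 0 carries the factor \<open>of_nat 0\<close>, so undoing the
    shift adds nothing to the sum.\<close>
  from sums_Suc[OF this]
  have "(\<lambda>j. of_nat j * d j * (z\<^sup>2) ^ j) sums (z\<^sup>2 * H' (z\<^sup>2))"
    by simp
  then have "(\<lambda>j. z ^ q * (of_nat q * (d j * (z\<^sup>2) ^ j) + 2 * (of_nat j * d j * (z\<^sup>2) ^ j)))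
      sums (z ^ q * (of_nat q * H (z\<^sup>2) + 2 * (z\<^sup>2 * H' (z\<^sup>2))))"
    unfolding H_def by (intro sums_mult sums_add summable_sums sm z2)
  also have "(\<lambda>j. z ^ q * (of_nat q * (d j * (z\<^sup>2) ^ j) + 2 * (of_nat j * d j * (z\<^sup>2) ^ j)))
      = weighted_term c q s z"
  proof
    fix j
    have "z ^ q * (of_nat q * (d j * (z\<^sup>2) ^ j) + 2 * (of_nat j * d j * (z\<^sup>2) ^ j))
        = of_nat (2 * j + q) * d j * z ^ (2 * j + q)"
      unfolding power_add power_mult by (simp add: algebra_simps)
    also have "of_nat (2 * j + q) * d j = c j / of_nat (2 * j + q) ^ s"
    proof -
      have "of_nat (2 * j + q) \<noteq> (0 :: complex)"
        unfolding of_nat_eq_0_iff using q by simp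
      then show ?thesis
        unfolding d_def power_Suc times_divide_eq_right
        by (rule nonzero_mult_divide_mult_cancel_left)
    qed
    finally show "z ^ q * (of_nat q * (d j * (z\<^sup>2) ^ j) + 2 * (of_nat j * d j * (z\<^sup>2) ^ j))
        = weighted_term c q s z j"
      by (simp only: weighted_term_def times_divide_eq_left)
  qed
  finally have S: "weighted_series c q s z = z ^ q * (of_nat q * H (z\<^sup>2) + 2 * (z\<^sup>2 * H' (z\<^sup>2)))"
    unfolding weighted_series_def by (simp add: sums_iff)
  have "z ^ q = z * z ^ (q - 1)"
    using q by (cases q) simp_all
  with q have "weighted_series c q s z / z
      = of_nat q * z ^ (q - 1) * H (z\<^sup>2) + z ^ q * (H' (z\<^sup>2) * (2 * z))"
    by (cases "z = 0") (auto simp: S field_simps power2_eq_square)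
  with D have "((\<lambda>w. w ^ q * H (w\<^sup>2)) has_field_derivative weighted_series c q s z / z) (at z)"
    by simp
  then show ?thesis
    by (rule has_field_derivative_transform_within_open[where S = "ball 0 1"])
      (use z series_eq in auto)
qed

section \<open>Iterated integrals computed from primitives\<close>

lemma contour_integral_linepath_0:
  assumes "\<And>t. norm t < 1 \<Longrightarrow> (G has_field_derivative g t) (at t)"
    and "G 0 = 0" and "norm z < 1"
  shows "contour_integral (linepath 0 z) g = G z"
proof -
  have "path_image (linepath 0 z) \<subseteq> ball 0 1"
    using assms(3) by (simp add: closed_segment_subset)
  from contour_integral_primitive[OF _ _ this, of G g]
  have "(g has_contour_integral G z - G 0) (linepath 0 z)"
    using assms(1) by (simp add: has_field_derivative_at_within)
  then show ?thesis
    using assms(2) by (simp add: contour_integral_unique)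
qed

text \<open>The derivative is prescribed at \<open>t = 0\<close> as well. There
  \<open>\<omega>\<^sub>0\<close> and \<open>\<omega>\<^sub>3\<close> take the value 0 by
  \<open>1 / 0 = 0\<close>, so for these forms \<open>G\<close> must have derivative 0 at the
  origin.\<close>

lemma iterated_integral_Cons:
  assumes "\<And>t. norm t < 1 \<Longrightarrow> (G has_field_derivative \<phi> t * iterated_integral W t) (at t)"
    and "G 0 = 0" and "norm z < 1"
  shows "iterated_integral (\<phi> # W) z = G z"
  using contour_integral_linepath_0[OF assms] by simp

lemma iterated_integral_replicate_\<omega>\<^sub>0:
  assumes c: "conv_radius c \<ge> 1" and q: "q \<ge> 2"
    and W: "\<And>t. norm t < 1 \<Longrightarrow> iterated_integral W t = weighted_series c q s t" and z: "norm z < 1"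
  shows "iterated_integral (replicate k \<omega>\<^sub>0 @ W) z = weighted_series c q (k + s) z"
  using z
\<comment> \<open>\<open>z\<close> is generalized because the inner integral is needed at every
  point \<open>t\<close> of the disc.\<close>
proof (induction k arbitrary: z)
  case (Suc k)
  show ?case
    unfolding replicate_Suc append_Cons add_Suc
  proof (rule iterated_integral_Cons[OF _ _ Suc.prems])
    fix t :: complex
    assume "norm t < 1"
    then show "(weighted_series c q (Suc (k + s)) has_field_derivative
        \<omega>\<^sub>0 t * iterated_integral (replicate k \<omega>\<^sub>0 @ W) t) (at t)"
      using has_field_derivative_weighted_series[OF c _ q, of t "k + s"] by (simp add: Suc.IH \<omega>\<^sub>0_def)
  qed (use q in \<open>simp add: weighted_series_at_0\<close>)
qed (use W in simp)

section \<open>The coefficients of \<open>b\<close> and the differential equation\<close>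

definition coeff_b :: "nat \<Rightarrow> complex" where
  "coeff_b m = 4 ^ m / of_nat ((2 * m) choose m)"

lemma b_eq_coeff_b: "b m z = coeff_b m * z ^ (2 * m)"
  by (simp add: b_def coeff_b_def)

lemma coeff_b_nonzero: "coeff_b m \<noteq> 0"
  by (simp add: coeff_b_def)

text \<open>Passing from \<open>m\<close> to \<open>m + 1\<close> multiplies the central binomial
  coefficient by \<open>(2m+2)(2m+1) / (m+1)^2\<close>. Since \<open>4 (m+1)^2 = (2m+2)^2\<close>,
  one factor \<open>2m+2\<close> cancels.\<close>

lemma coeff_b_Suc:
  "coeff_b (Suc m) = coeff_b m * of_nat (2 * m + 2) / of_nat (2 * m + 1)"
proof -
  have fact_eq: "coeff_b k = 4 ^ k * fact k * fact k / fact (2 * k)" for k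
    by (simp add: coeff_b_def binomial_fact)
  have "fact (2 * Suc m) = of_nat (2 * m + 2) * of_nat (2 * m + 1) * (fact (2 * m) :: complex)"
    by (simp add: algebra_simps)
  moreover have "fact (Suc m) = of_nat (Suc m) * (fact m :: complex)"
    by simp
  moreover have "of_nat (2 * m + 1) \<noteq> (0 :: complex)" "of_nat (2 * m + 2) \<noteq> (0 :: complex)"
    unfolding of_nat_eq_0_iff by simp_all
  moreover have "4 * of_nat (Suc m) * of_nat (Suc m) = of_nat (2 * m + 2) * (of_nat (2 * m + 2) :: complex)"
    by (simp add: algebra_simps)
  ultimately show ?thesis
    unfolding fact_eq by (simp add: divide_simps del: of_nat_add of_nat_mult of_nat_Suc fact_Suc) algebra
qed

text \<open>By the recurrence, consecutive coefficients have ratio \<open>(2m+1) / (2m+2)\<close>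
  with \<open>m = n + j\<close>, which tends to 1.\<close>

lemma conv_radius_coeff_b: "conv_radius (\<lambda>j. coeff_b (n + j)) = 1"
proof (rule conv_radius_ratio_limit_nonzero)
  have "norm (coeff_b (n + j)) / norm (coeff_b (n + Suc j)) = 1 - 1 / (2 * real (n + Suc j))" for j
  proof -
    have "norm (coeff_b (n + j)) / norm (coeff_b (n + Suc j))
        = real (2 * (n + j) + 1) / real (2 * (n + j) + 2)"
      using coeff_b_nonzero[of "n + j"]
      unfolding add_Suc_right coeff_b_Suc norm_mult norm_divide norm_of_nat by simp
    then show ?thesis
      by (simp add: field_simps)
  qed
  moreover have "(\<lambda>j. 1 - 1 / (2 * real (n + Suc j))) \<longlonglongrightarrow> 1"
    by real_asymp
  ultimately show "(\<lambda>j. norm (coeff_b (n + j)) / norm (coeff_b (n + Suc j))) \<longlonglongrightarrow> 1"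
    by simp
qed (simp_all add: one_ereal_def)

text \<open>This is \<open>F\<close> of the overview: index \<open>j\<close> stands for
  \<open>m = n + j\<close>, and \<open>2 * j + q\<close> is \<open>2m+1\<close>.\<close>

abbreviation F_odd :: "nat \<Rightarrow> nat \<Rightarrow> complex \<Rightarrow> complex" where
  "F_odd n \<equiv> weighted_series (\<lambda>j. coeff_b (n + j)) (2 * n + 1)"

text \<open>Here \<open>j\<close> stands for \<open>m = n + 1 + j\<close> and the exponent is
  \<open>2m\<close>, so the sum runs over \<open>m > n\<close>.\<close>

abbreviation F_even :: "nat \<Rightarrow> nat \<Rightarrow> complex \<Rightarrow> complex" where
  "F_even n \<equiv> weighted_series (\<lambda>j. coeff_b (Suc n + j)) (2 * n + 2)"

lemma F_odd_sums:
  "norm z < 1 \<Longrightarrow> weighted_term (\<lambda>j. coeff_b (n + j)) (2 * n + 1) s z sums F_odd n s z"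
  by (rule weighted_term_sums) (simp_all add: conv_radius_coeff_b)

text \<open>Termwise, the factor \<open>2m+2\<close> of the recurrence cancels the even denominator:
  \<open>a (m+1) / (2m+2) = a m / (2m+1)\<close>.\<close>

lemma F_even_1:
  assumes "norm z < 1"
  shows "F_even n 1 z = z * F_odd n 1 z"
proof -
  have "weighted_term (\<lambda>j. coeff_b (Suc n + j)) (2 * n + 2) 1 z j
      = z * weighted_term (\<lambda>j. coeff_b (n + j)) (2 * n + 1) 1 z j" for j
  proof -
    define m where "m = n + j"
    have "of_nat (2 * m + 2) \<noteq> (0 :: complex)"
      unfolding of_nat_eq_0_iff by simp
    then have "coeff_b (Suc m) * z ^ (2 * m + 2) / of_nat (2 * m + 2)
        = z * (coeff_b m * z ^ (2 * m + 1) / of_nat (2 * m + 1))"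
      unfolding coeff_b_Suc by (simp del: of_nat_add of_nat_mult)
    moreover have "2 * j + (2 * n + 2) = 2 * m + 2" "2 * j + (2 * n + 1) = 2 * m + 1"
        "Suc n + j = Suc m"
      by (simp_all add: m_def)
    ultimately show ?thesis
      unfolding weighted_term_def by (simp only: m_def[symmetric] power_one_right)
  qed
  then show ?thesis
    using sums_mult[OF F_odd_sums[OF assms, of n 1], of z]
    by (simp add: weighted_series_def sums_iff)
qed

text \<open>As \<open>F_odd n 0 z\<close> is \<open>z\<close> times the derivative of
  \<open>F_odd n 1\<close>, this is the equation of the overview multiplied by \<open>z\<close>,
  free of division. It follows from \<open>a (m+1) = a m + a m / (2m+1)\<close>: the shifted series
  is \<open>z\<^sup>2\<close> times the sum of the two series, and the unmatched first term gives
  the right-hand side.\<close>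

lemma F_odd_ode:
  assumes "norm z < 1"
  shows "(1 - z\<^sup>2) * F_odd n 0 z - z\<^sup>2 * F_odd n 1 z = z * b n z"
proof -
  let ?t = "weighted_term (\<lambda>j. coeff_b (n + j)) (2 * n + 1)"
  have "?t 0 z (Suc j) = z\<^sup>2 * (?t 0 z j + ?t 1 z j)" for j
  proof -
    define m x where "m = n + j" and "x = (of_nat (2 * m + 1) :: complex)"
    have "x \<noteq> 0"
      unfolding x_def of_nat_eq_0_iff by simp
    moreover have "of_nat (2 * m + 2) = x + 1"
      by (simp add: x_def)
    ultimately have "coeff_b (Suc m) = coeff_b m + coeff_b m / x"
      unfolding coeff_b_Suc x_def[symmetric] by (simp add: field_simps)
    then have "coeff_b (Suc m) * z ^ (2 * m + 1 + 2)
        = z\<^sup>2 * (coeff_b m * z ^ (2 * m + 1) + coeff_b m * z ^ (2 * m + 1) / x)"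
      by (simp only: power_add[of z "2 * m + 1" 2]) (simp add: algebra_simps)
    moreover have "2 * j + (2 * n + 1) = 2 * m + 1" "2 * Suc j + (2 * n + 1) = 2 * m + 1 + 2"
        "n + Suc j = Suc m"
      by (simp_all add: m_def)
    ultimately show ?thesis
      unfolding weighted_term_def
      by (simp only: m_def[symmetric] x_def[symmetric] power_one_right power_0 div_by_1)
  qed
  moreover have "(\<lambda>j. z\<^sup>2 * (?t 0 z j + ?t 1 z j)) sums (z\<^sup>2 * (F_odd n 0 z + F_odd n 1 z))"
    by (intro sums_mult sums_add F_odd_sums assms)
  ultimately have "?t 0 z sums (z\<^sup>2 * (F_odd n 0 z + F_odd n 1 z) + ?t 0 z 0)"
    using sums_Suc[of "?t 0 z"] by simp
  moreover have "?t 0 z 0 = z * b n z"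
    by (simp add: weighted_term_def b_eq_coeff_b)
  ultimately have "F_odd n 0 z = z\<^sup>2 * (F_odd n 0 z + F_odd n 1 z) + z * b n z"
    using sums_unique2[OF F_odd_sums[OF assms, of n 0]] by metis
  then show ?thesis
    by (simp add: algebra_simps)
qed

section \<open>The square root and the inner integrals\<close>

text \<open>The real part is positive because \<open>z\<^sup>2\<close> has norm below 1. Off the
  closed negative axis \<open>csqrt\<close> is differentiable and nonzero.\<close>

lemma one_minus_square_not_nonpos:
  fixes z :: complex
  assumes "norm z < 1"
  shows "1 - z\<^sup>2 \<notin> \<real>\<^sub>\<le>\<^sub>0"
proof
  assume "1 - z\<^sup>2 \<in> \<real>\<^sub>\<le>\<^sub>0"
  then have "Re (1 - z\<^sup>2) \<le> 0"
    by (simp add: complex_nonpos_Reals_iff)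
  moreover have "Re (z\<^sup>2) \<le> norm (z\<^sup>2)"
    by (rule complex_Re_le_cmod)
  moreover have "norm (z\<^sup>2) < 1"
    using assms by (simp add: norm_power power_less_one_iff)
  ultimately show False
    by simp
qed

lemma csqrt_one_minus_square_nonzero:
  assumes "norm z < 1"
  shows "csqrt (1 - z\<^sup>2) \<noteq> 0"
  using one_minus_square_not_nonpos[OF assms] by (metis csqrt_eq_0 nonpos_Reals_zero_I)

text \<open>With \<open>r = csqrt (1 - t\<^sup>2)\<close>, the derivative of \<open>r F\<close> is
  \<open>((1 - t\<^sup>2) F' - t F) / r\<close>, and the differential equation turns the numerator
  into \<open>b n t\<close>.\<close>

lemma iterated_integral_b\<omega>\<^sub>1:
  assumes "n > 0" and z: "norm z < 1"
  shows "iterated_integral [b\<omega>\<^sub>1 n] z = csqrt (1 - z\<^sup>2) * F_odd n 1 z"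
proof (rule iterated_integral_Cons[OF _ _ z])
  fix t :: complex
  assume t: "norm t < 1"
  let ?r = "csqrt (1 - t\<^sup>2)"
  have r: "?r \<noteq> 0" "?r * ?r = 1 - t\<^sup>2"
    using csqrt_one_minus_square_nonzero[OF t] power2_csqrt[of "1 - t\<^sup>2"]
    by (simp_all add: power2_eq_square)
  have dF: "(F_odd n 1 has_field_derivative F_odd n 0 t / t) (at t)"
    using has_field_derivative_weighted_series[where s = 0] t assms(1)
    by (simp add: conv_radius_coeff_b)
  have "((\<lambda>t. csqrt (1 - t\<^sup>2) * F_odd n 1 t) has_field_derivative
      - (2 * t) / (2 * ?r) * F_odd n 1 t + F_odd n 0 t / t * ?r) (at t)"
    by (rule derivative_eq_intros dF one_minus_square_not_nonpos[OF t] refl | simp)+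
  moreover have "- (2 * t) / (2 * ?r) * F_odd n 1 t + F_odd n 0 t / t * ?r = b n t / ?r"
  \<comment> \<open>At 0 the left side vanishes by \<open>x / 0 = 0\<close>, and the right side
    because \<open>n > 0\<close> gives \<open>b n 0 = 0\<close>. Elsewhere the division-free
    equation can be divided by \<open>t\<close>.\<close>
  proof (cases "t = 0")
    case False
    have "t * ((F_odd n 0 t / t) * (?r * ?r) - t * F_odd n 1 t)
        = (1 - t\<^sup>2) * F_odd n 0 t - t\<^sup>2 * F_odd n 1 t"
      unfolding r(2) using False by (simp add: field_simps power2_eq_square)
    also have "\<dots> = t * b n t"
      by (rule F_odd_ode[OF t])
    finally have "b n t = (F_odd n 0 t / t) * (?r * ?r) - t * F_odd n 1 t"
      using False by simp
    then have "b n t / ?r = (F_odd n 0 t / t) * (?r * ?r) / ?r - t * F_odd n 1 t / ?r"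
      by (simp only: diff_divide_distrib)
    then show ?thesis
      using r(1) by simp
  qed (use assms(1) in \<open>simp add: b_def\<close>)
  ultimately show "((\<lambda>t. csqrt (1 - t\<^sup>2) * F_odd n 1 t) has_field_derivative
      b\<omega>\<^sub>1 n t * iterated_integral [] t) (at t)"
    by (simp add: b\<omega>\<^sub>1_def \<omega>\<^sub>1_def)
qed (simp add: weighted_series_at_0)

text \<open>The square root in \<open>\<omega>\<^sub>3\<close> cancels that of the inner integral
  and leaves \<open>F_odd n 1 t / t\<close>.\<close>

lemma iterated_integral_\<omega>\<^sub>3:
  assumes "n > 0" and z: "norm z < 1"
  shows "iterated_integral [\<omega>\<^sub>3, b\<omega>\<^sub>1 n] z = F_odd n 2 z"
proof (rule iterated_integral_Cons[OF _ _ z])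
  fix t :: complex
  assume t: "norm t < 1"
  have "(F_odd n 2 has_field_derivative F_odd n 1 t / t) (at t)"
    using has_field_derivative_weighted_series[where s = 1] t assms(1)
    by (simp add: conv_radius_coeff_b numeral_2_eq_2)
  then show "(F_odd n 2 has_field_derivative \<omega>\<^sub>3 t * iterated_integral [b\<omega>\<^sub>1 n] t) (at t)"
    unfolding iterated_integral_b\<omega>\<^sub>1[OF assms(1) t] \<omega>\<^sub>3_def
    using csqrt_one_minus_square_nonzero[OF t] by simp
qed (simp add: weighted_series_at_0)

text \<open>After the square roots cancel, no \<open>1 / t\<close> remains. Writing
  \<open>F_odd n 1 t\<close> as \<open>F_even n 1 t / t\<close> restores it, which moves the
  integration to the even series.\<close>

lemma iterated_integral_\<omega>\<^sub>1:
  assumes "n > 0" and z: "norm z < 1"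
  shows "iterated_integral [\<omega>\<^sub>1, b\<omega>\<^sub>1 n] z = F_even n 2 z"
proof (rule iterated_integral_Cons[OF _ _ z])
  fix t :: complex
  assume t: "norm t < 1"
  have "(F_even n 2 has_field_derivative F_even n 1 t / t) (at t)"
    using has_field_derivative_weighted_series[where s = 1] t conv_radius_coeff_b[of "Suc n"]
    by (simp add: numeral_2_eq_2)
  \<comment> \<open>At \<open>t = 0\<close> both sides are 0, the left one by convention.\<close>
  moreover have "F_even n 1 t / t = F_odd n 1 t"
    unfolding F_even_1[OF t] by (simp add: weighted_series_at_0)
  ultimately show "(F_even n 2 has_field_derivative \<omega>\<^sub>1 t * iterated_integral [b\<omega>\<^sub>1 n] t) (at t)"
    unfolding iterated_integral_b\<omega>\<^sub>1[OF assms(1) t] \<omega>\<^sub>1_def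
    using csqrt_one_minus_square_nonzero[OF t] by simp
qed (simp add: weighted_series_at_0)

section \<open>The series as unordered sums over \<open>m\<close>\<close>

lemma has_sum_F_even:
  assumes "norm z < 1"
  shows "((\<lambda>m. b m z / (2 * of_nat m) ^ s) has_sum F_even n s z) {m. m > n}"
proof -
  have "bij_betw (\<lambda>j. Suc n + j) UNIV {m. m > n}"
    by (rule bij_betw_byWitness[where f' = "\<lambda>m. m - Suc n"]) auto
  moreover have "(weighted_term (\<lambda>j. coeff_b (Suc n + j)) (2 * n + 2) s z has_sum F_even n s z) UNIV"
    using assms conv_radius_coeff_b[of "Suc n"] by (intro weighted_term_has_sum) simp_all
  moreover have "weighted_term (\<lambda>j. coeff_b (Suc n + j)) (2 * n + 2) s z
      = (\<lambda>j. b (Suc n + j) z / (2 * of_nat (Suc n + j)) ^ s)"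
    by (simp add: weighted_term_def b_eq_coeff_b fun_eq_iff algebra_simps)
  ultimately show ?thesis
    using has_sum_reindex_bij_betw[of "\<lambda>j. Suc n + j" UNIV "{m. m > n}"
      "\<lambda>m. b m z / (2 * of_nat m) ^ s"] by simp
qed

lemma bij_betw_add_UNIV: "bij_betw (\<lambda>j. n + j) UNIV {m :: nat. m \<ge> n}"
  by (rule bij_betw_byWitness[where f' = "\<lambda>m. m - n"]) auto

text \<open>The factor \<open>z\<close> accounts for the odd power \<open>z ^ (2m+1)\<close>, since
  \<open>b m z\<close> contains only \<open>z ^ (2m)\<close>.\<close>

lemma has_sum_F_odd:
  assumes "norm z < 1"
  shows "((\<lambda>m. z * (b m z / (2 * of_nat m + 1) ^ s)) has_sum F_odd n s z) {m. m \<ge> n}"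
proof -
  have "(weighted_term (\<lambda>j. coeff_b (n + j)) (2 * n + 1) s z has_sum F_odd n s z) UNIV"
    using assms conv_radius_coeff_b[of n] by (intro weighted_term_has_sum) simp_all
  moreover have "weighted_term (\<lambda>j. coeff_b (n + j)) (2 * n + 1) s z
      = (\<lambda>j. z * (b (n + j) z / (2 * of_nat (n + j) + 1) ^ s))"
    by (simp add: weighted_term_def b_eq_coeff_b fun_eq_iff algebra_simps)
  ultimately show ?thesis
    using has_sum_reindex_bij_betw[OF bij_betw_add_UNIV[of n],
      of "\<lambda>m. z * (b m z / (2 * of_nat m + 1) ^ s)"] by simp
qed

lemma has_sum_odd_denominator:
  assumes "n > 0" "norm z < 1"
  shows "((\<lambda>m. b m z / (2 * of_nat m + 1) ^ s) has_sum F_odd n s z / z) {m. m \<ge> n}"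
proof (cases "z = 0")
  case True
  \<comment> \<open>Every \<open>m\<close> in the range is positive, so each \<open>b m 0\<close>
    vanishes, in agreement with \<open>F_odd n s z / z\<close> at \<open>z = 0\<close>.\<close>
  have "((\<lambda>m. b m z / (2 * of_nat m + 1) ^ s) has_sum 0) {m. m \<ge> n}"
    by (rule has_sum_0) (use assms(1) True in \<open>auto simp: b_def\<close>)
  then show ?thesis
    using True by simp
next
  case False
  then show ?thesis
    using has_sum_cmult_right[OF has_sum_F_odd[OF assms(2), of s n], of "1 / z"] by simp
qed

text \<open>Replace \<open>m\<close> by \<open>m + 1\<close>, so that the denominator becomes
  \<open>x = 2m+1\<close>. The recurrence gives \<open>b (m+1) z = z^2 * b m z * (1 + 1/x)\<close>;
  the summands 1 and \<open>1/x\<close> yield the exponents \<open>s\<close> and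
  \<open>s + 1\<close>, which is where the form \<open>\<omega>\<^sub>0 + 1\<close> comes
  from.\<close>

lemma has_sum_pred_denominator:
  assumes "norm z < 1"
  shows "((\<lambda>m. b m z / (2 * of_nat m - 1) ^ s) has_sum
    z * (F_odd n (Suc s) z + F_odd n s z)) {m. m > n}"
proof -
  have bij: "bij_betw Suc {m. m \<ge> n} {m. m > n}"
    by (rule bij_betw_byWitness[where f' = "\<lambda>m. m - 1"]) auto
  have "((\<lambda>m. z * (z * (b m z / (2 * of_nat m + 1) ^ Suc s) + z * (b m z / (2 * of_nat m + 1) ^ s)))
      has_sum z * (F_odd n (Suc s) z + F_odd n s z)) {m. m \<ge> n}"
    by (intro has_sum_cmult_right has_sum_add has_sum_F_odd assms)
  also have "(\<lambda>m. z * (z * (b m z / (2 * of_nat m + 1) ^ Suc s) + z * (b m z / (2 * of_nat m + 1) ^ s)))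
      = (\<lambda>m. b (Suc m) z / (2 * of_nat (Suc m) - 1) ^ s)"
  proof
    fix m
    define x where "x = 2 * of_nat m + (1 :: complex)"
    have nz: "x \<noteq> 0"
      unfolding x_def using of_nat_neq_0[of "2 * m", where 'a = complex] by (simp add: add.commute)
    have b_Suc: "b (Suc m) z = z * z * b m z * ((x + 1) / x)"
      by (simp add: b_eq_coeff_b coeff_b_Suc x_def algebra_simps)
    have "z * (z * (b m z / x ^ Suc s) + z * (b m z / x ^ s)) = b (Suc m) z / x ^ s"
      unfolding b_Suc using nz by (simp add: field_simps)
    moreover have "2 * of_nat (Suc m) - 1 = x"
      by (simp add: x_def)
    ultimately show "z * (z * (b m z / (2 * of_nat m + 1) ^ Suc s) + z * (b m z / (2 * of_nat m + 1) ^ s))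
        = b (Suc m) z / (2 * of_nat (Suc m) - 1) ^ s"
      by (simp only: x_def[symmetric])
  qed
  finally show ?thesis
    using has_sum_reindex_bij_betw[OF bij, of "\<lambda>m. b m z / (2 * of_nat m - 1) ^ s"] by simp
qed

theorem theorem6p3:
  fixes n :: nat and z :: complex
  assumes "n > 0" and "norm z < 1"
  shows
    "((\<lambda>m. b m z / (2 * of_nat m)) has_sum
        f\<^sub>2 z * iterated_integral [b\<omega>\<^sub>1 n] z) {m. m > n} \<and>
     (\<forall>s::nat. s \<ge> 2 \<longrightarrow>
       ((\<lambda>m. b m z / (2 * of_nat m) ^ s) has_sum
          f\<^sub>1 z * iterated_integral (replicate (s - 2) \<omega>\<^sub>0 @ [\<omega>\<^sub>1, b\<omega>\<^sub>1 n]) z) {m. m > n}) \<and>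
     ((\<lambda>m. b m z / (2 * of_nat m + 1)) has_sum
        f\<^sub>2\<^sub>0 z * iterated_integral [b\<omega>\<^sub>1 n] z) {m. m \<ge> n} \<and>
     (\<forall>s::nat. s \<ge> 2 \<longrightarrow>
       ((\<lambda>m. b m z / (2 * of_nat m + 1) ^ s) has_sum
          f\<^sub>3 z * iterated_integral (replicate (s - 2) \<omega>\<^sub>0 @ [\<omega>\<^sub>3, b\<omega>\<^sub>1 n]) z) {m. m \<ge> n}) \<and>
     ((\<lambda>m. b m z / (2 * of_nat m - 1)) has_sum
        f\<^sub>5 z * iterated_integral [\<omega>\<^sub>3, b\<omega>\<^sub>1 n] z + f\<^sub>2 z * iterated_integral [b\<omega>\<^sub>1 n] z) {m. m > n} \<and>
     (\<forall>s::nat. s \<ge> 2 \<longrightarrow>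
       ((\<lambda>m. b m z / (2 * of_nat m - 1) ^ s) has_sum
          f\<^sub>5 z * (iterated_integral (\<omega>\<^sub>0 # replicate (s - 2) \<omega>\<^sub>0 @ [\<omega>\<^sub>3, b\<omega>\<^sub>1 n]) z
                + iterated_integral (replicate (s - 2) \<omega>\<^sub>0 @ [\<omega>\<^sub>3, b\<omega>\<^sub>1 n]) z)) {m. m > n})"
proof -
  have even: "iterated_integral (replicate k \<omega>\<^sub>0 @ [\<omega>\<^sub>1, b\<omega>\<^sub>1 n]) z = F_even n (k + 2) z" for k
    using conv_radius_coeff_b[of "Suc n"]
    by (intro iterated_integral_replicate_\<omega>\<^sub>0 iterated_integral_\<omega>\<^sub>1 assms) simp_all
  have odd: "iterated_integral (replicate k \<omega>\<^sub>0 @ [\<omega>\<^sub>3, b\<omega>\<^sub>1 n]) z = F_odd n (k + 2) z" for k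
    using assms(1)
    by (intro iterated_integral_replicate_\<omega>\<^sub>0 iterated_integral_\<omega>\<^sub>3 assms)
      (simp_all add: conv_radius_coeff_b)
  \<comment> \<open>The leading \<open>\<omega>\<^sub>0\<close> merely lengthens the block of
    \<open>\<omega>\<^sub>0\<close> by one.\<close>
  have odd_Suc: "iterated_integral (\<omega>\<^sub>0 # replicate k \<omega>\<^sub>0 @ [\<omega>\<^sub>3, b\<omega>\<^sub>1 n]) z = F_odd n (Suc (k + 2)) z" for k
    using odd[of "Suc k"] by (simp del: iterated_integral.simps)
  note r = csqrt_one_minus_square_nonzero[OF assms(2)]
  \<comment> \<open>The prefactors \<open>f\<^sub>2\<close> and \<open>f\<^sub>2\<^sub>0\<close>
    contain the reciprocal of the square root left over from the innermost integral.\<close>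
  have f2: "f\<^sub>2 z * iterated_integral [b\<omega>\<^sub>1 n] z = z * F_odd n 1 z"
    unfolding iterated_integral_b\<omega>\<^sub>1[OF assms] f\<^sub>2_def using r by simp
  have f20: "f\<^sub>2\<^sub>0 z * iterated_integral [b\<omega>\<^sub>1 n] z = F_odd n 1 z / z"
    unfolding iterated_integral_b\<omega>\<^sub>1[OF assms] f\<^sub>2\<^sub>0_def using r by simp
  show ?thesis
  proof (intro conjI allI impI)
    show "((\<lambda>m. b m z / (2 * of_nat m)) has_sum f\<^sub>2 z * iterated_integral [b\<omega>\<^sub>1 n] z) {m. m > n}"
      unfolding f2 using has_sum_F_even[OF assms(2), of 1 n]
      by (simp only: F_even_1[OF assms(2)] power_one_right)
    show "((\<lambda>m. b m z / (2 * of_nat m + 1)) has_sum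
        f\<^sub>2\<^sub>0 z * iterated_integral [b\<omega>\<^sub>1 n] z) {m. m \<ge> n}"
      unfolding f20 using has_sum_odd_denominator[OF assms, of 1] by (simp only: power_one_right)
    have "f\<^sub>5 z * iterated_integral [\<omega>\<^sub>3, b\<omega>\<^sub>1 n] z + f\<^sub>2 z * iterated_integral [b\<omega>\<^sub>1 n] z
        = z * (F_odd n (Suc 1) z + F_odd n 1 z)"
      unfolding f2 iterated_integral_\<omega>\<^sub>3[OF assms] f\<^sub>5_def distrib_left by (simp only: Suc_1)
    then show "((\<lambda>m. b m z / (2 * of_nat m - 1)) has_sum
        f\<^sub>5 z * iterated_integral [\<omega>\<^sub>3, b\<omega>\<^sub>1 n] z + f\<^sub>2 z * iterated_integral [b\<omega>\<^sub>1 n] z) {m. m > n}"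
      using has_sum_pred_denominator[OF assms(2), of 1 n] by (simp only: power_one_right)
    fix s :: nat
    assume "s \<ge> 2"
    \<comment> \<open>The natural subtraction is exact since \<open>s \<ge> 2\<close>; the inner two
      forms account for the exponent 2 and the \<open>s - 2\<close> forms
      \<open>\<omega>\<^sub>0\<close> for the rest.\<close>
    then have s: "s - 2 + 2 = s"
      by simp
    show "((\<lambda>m. b m z / (2 * of_nat m) ^ s) has_sum
        f\<^sub>1 z * iterated_integral (replicate (s - 2) \<omega>\<^sub>0 @ [\<omega>\<^sub>1, b\<omega>\<^sub>1 n]) z) {m. m > n}"
      unfolding even s f\<^sub>1_def mult_1 by (rule has_sum_F_even[OF assms(2)])
    show "((\<lambda>m. b m z / (2 * of_nat m + 1) ^ s) has_sum
        f\<^sub>3 z * iterated_integral (replicate (s - 2) \<omega>\<^sub>0 @ [\<omega>\<^sub>3, b\<omega>\<^sub>1 n]) z) {m. m \<ge> n}"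
      unfolding odd s f\<^sub>3_def using has_sum_odd_denominator[OF assms, of s] by simp
    show "((\<lambda>m. b m z / (2 * of_nat m - 1) ^ s) has_sum
        f\<^sub>5 z * (iterated_integral (\<omega>\<^sub>0 # replicate (s - 2) \<omega>\<^sub>0 @ [\<omega>\<^sub>3, b\<omega>\<^sub>1 n]) z
              + iterated_integral (replicate (s - 2) \<omega>\<^sub>0 @ [\<omega>\<^sub>3, b\<omega>\<^sub>1 n]) z)) {m. m > n}"
      unfolding odd odd_Suc s f\<^sub>5_def by (rule has_sum_pred_denominator[OF assms(2)])
  qed
qed

end
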